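(* Let $G$ be an irreducible well-generated finite complex reflection group of rank $n$, and let $t=(t_1,\dots,t_n)$, $t_i=F_i^{\mathrm{fl}}(u)$, be a flat coordinate system on the orbit space $X=U_n/G$ given by flat basic invariants of $G$. Then the potential vector field $\vec g=(g_1,\dots,g_n)$ for the $G$-quotient system has entries that are polynomials in $t=(t_1,\dots,t_n)$.
   Context: **Setting.** "Well-generated" means that $G$ (irreducible of rank $n$, acting on $U_n=\mathbb{C}^n$ with coordinates $u$) is generated by $n$ reflections. Let $F_1(u),\dots,F_n(u)$ be a fundamental system of homogeneous $G$-invariant polynomials of degrees $d_1\le\dots\le d_n$; $x_i=F_i(u)$ are coordinates on $X=U_n/G$, $x'=(x_1,\dots,x_{n-1})$. Let $h(x)$ be the reduced defining polynomial of the branch locus $D\subset X$; it is (after scaling) monic of degree $n$ in $x_n$. Weights: $w(x_i)=d_i/d_n$. **Vector fields.** Write $h(x)=\prod_i(x_n-z_i^0(x'))$, $z_i=z_i^0(x')-x_n$, $P_h=(\partial z_j/\partial x_i)_{i,j}$ (generically invertible), $M_{\mathcal V}(x)=-P_h\operatorname{diag}[z_1,\dots,z_n]P_h^{-1}$, $(V_n,\dots,V_1)^t=M_{\mathcal V}(\partial_{x_1},\dots,\partial_{x_n})^t$, $M_{\tilde{\mathcal V}}=M_{\mathcal V}\left(\frac{\partial x}{\partial u}\right)^{-1}$ with $\left(\frac{\partial x}{\partial u}\right)=\left(\frac{\partial x_j}{\partial u_i}\right)_{i,j}$, and $(\tilde V_n,\dots,\tilde V_1)^t=M_{\tilde{\mathcal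 V}}(\partial_{u_1},\dots,\partial_{u_n})^t$ (pull-backs of the $V_i$ to $U_n$). **$G$-quotient system.** Put $B_\infty=\operatorname{diag}[w(x_1),\dots,w(x_n)]-(1+\frac1{d_n})I_n$. There is an upper triangular $R(x')\in GL(n,\mathbb{C}[x'])$, $R(0)=I_n$, with weighted homogeneous entries of weights $w(R_{ij})=w(x_j)-w(x_i)$, such that for every homogeneous linear function $y(u)$ the vector $Y=-B_\infty^{-1}R(x')(\tilde V_ny,\dots,\tilde V_1y)^t$ satisfies $$dY=T^{-1}\Bigl(\sum_{k=1}^n\tilde B^{(k)}(x')\,dx_k\Bigr)B_\infty Y,\qquad T(x)=T_0(x')-x_nI_n,\quad\tilde B^{(n)}=I_n,$$ where $T_0,\tilde B^{(k)}$ have entries in $\mathbb{C}[x']$ and, with $\tilde\Omega=\sum_k\tilde B^{(k)}dx_k$, one has $[T,\tilde\Omega]=O$, $\tilde\Omega\wedge\tilde\Omega=O$, $dT+\tilde\Omega+[\tilde\Omega,B_\infty]=O$, $d\tilde\Omega=O$. This is the $G$-quotient system. **Induced Saito structure and flat basic invariants.** With $\mathbf e_1,\dots,\mathbf e_n$ the standard frame of $X\times\mathbb{C}^n$, $\tilde\Omega^t_Y(\mathbf e_j)=\sum_i\tilde\Omega_{ji}(Y)\mathbf e_i$, $T^t(\mathbf e_j)=\sum_iT_{ji}\mathbf e_i$, the map $\varphi:TX\to X\times\mathbb{C}^n$, $\varphi(Y)=\tilde\Omega_Y^t(\mathbf e_n)$, is an isomorphism, and $\nabla^0=\varphi^{-1}\circ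 d\circ\varphi$, $\Phi=\varphi^{-1}\circ\tilde\Omega^t\circ\varphi$, $e=\varphi^{-1}(\mathbf e_n)$, $E=-\varphi^{-1}(T^t\mathbf e_n)$ is the induced Saito structure (without metric) on $X$. Flat basic invariants of $G$ are homogeneous generators $F_i^{\mathrm{fl}}(u)$ of $\mathbb{C}[u]^G$, $\deg F_i^{\mathrm{fl}}=d_i$, such that $t_i=F_i^{\mathrm{fl}}$ is a flat coordinate system on $X$, i.e. $\nabla^0(\partial_{t_i})=0$ for all $i$; they are normalized so that $e=\partial_{t_n}$, and $E=\sum_iw_it_i\partial_{t_i}$ with $w_i=d_i/d_n$. **Potential vector field.** Define the matrix $\mathcal T$ by $-\Phi_{\partial_{t_j}}(E)=\sum_i\mathcal T_{ji}\partial_{t_i}$; let $\mathcal C$ be the unique matrix of functions with $\mathcal T=-E\mathcal C$ (entrywise derivative along $E$) and $E\,\mathcal C_{ij}=(1-w_i+w_j)\mathcal C_{ij}$. The potential vector field is the unique $n$-tuple $\vec g=(g_1,\dots,g_n)$ with $\mathcal C_{ij}=\partial g_j/\partial t_i$ and $Eg_j=(1+w_j)g_j$; explicitly $g_j=\frac1{1+w_j}\sum_iw_it_i\mathcal C_{ij}$. *)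

theory Defs
  imports "HOL-Analysis.Analysis" "HOL-Algebra.Generated_Groups"
begin

text \<open>
  The rank is \<open>n = CARD('n)\<close> for an index type \<open>'n\<close> that is finite and linearly ordered, so that
  \<open>1 < ... < n\<close> is the order of \<open>'n\<close>. Points of \<open>U\<^sub>n\<close> and, after a choice of basic invariants, points
  of \<open>X = U\<^sub>n/G\<close> are elements of \<open>'n cvec\<close>; functions on \<open>X\<close> are functions of \<open>x\<close>.
\<close>

type_synonym 'n cvec = "complex ^ 'n"
type_synonym 'n cmat = "complex ^ 'n ^ 'n"

definition last_ix :: "'n::{finite,linorder}"
  where "last_ix = Max UNIV"


section \<open>Polynomial and holomorphic functions on complex n-space\<close>

text \<open>Polynomials are identified with polynomial functions; \<open>S\<close> is the set of admitted exponents.\<close>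

definition poly_fun :: "('n::finite \<Rightarrow> nat) set \<Rightarrow> ('n cvec \<Rightarrow> complex) \<Rightarrow> bool"
  where "poly_fun S f \<longleftrightarrow> (\<exists>M c. finite M \<and> M \<subseteq> S \<and>
           f = (\<lambda>x. \<Sum>\<alpha>\<in>M. c \<alpha> * (\<Prod>i\<in>UNIV. x $ i ^ \<alpha> i)))"

abbreviation is_poly :: "(('n::finite) cvec \<Rightarrow> complex) \<Rightarrow> bool"
  where "is_poly \<equiv> poly_fun UNIV"

text \<open>Exponents of monomials in \<open>x' = (x\<^sub>1, ..., x\<^bsub>n-1\<^esub>)\<close>.\<close>

definition xprime :: "('n::{finite,linorder} \<Rightarrow> nat) set"
  where "xprime = {\<alpha>. \<alpha> last_ix = 0}"

definition weight_exps :: "('n::finite \<Rightarrow> real) \<Rightarrow> real \<Rightarrow> ('n \<Rightarrow> nat) set"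
  where "weight_exps w r = {\<alpha>. (\<Sum>i\<in>UNIV. real (\<alpha> i) * w i) = r}"

definition homogeneous_poly :: "nat \<Rightarrow> (('n::finite) cvec \<Rightarrow> complex) \<Rightarrow> bool"
  where "homogeneous_poly k = poly_fun (weight_exps (\<lambda>_. 1) (real k))"

definition holo_on :: "(('n::finite) cvec \<Rightarrow> complex) \<Rightarrow> ('n cvec) set \<Rightarrow> bool"
  where "holo_on f W \<longleftrightarrow> open W \<and>
           (\<forall>x\<in>W. \<exists>a. (f has_derivative (\<lambda>v. \<Sum>i\<in>UNIV. a i * v $ i)) (at x))"

definition upd :: "('n::finite) cvec \<Rightarrow> 'n \<Rightarrow> complex \<Rightarrow> 'n cvec"
  where "upd x i s = (\<chi> k. if k = i then s else x $ k)"

definition pd :: "'n::finite \<Rightarrow> ('n cvec \<Rightarrow> complex) \<Rightarrow> 'n cvec \<Rightarrow> complex"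
  where "pd i f x = deriv (\<lambda>s. f (upd x i s)) (x $ i)"

text \<open>Rows are indexed by the variables, columns by the functions: \<open>(\<partial>f\<^sub>j/\<partial>x\<^sub>i)\<^bsub>i,j\<^esub>\<close>.\<close>

definition jacobian :: "(('n::finite) cvec \<Rightarrow> 'n cvec) \<Rightarrow> 'n cvec \<Rightarrow> 'n cmat"
  where "jacobian f x = (\<chi> i j. pd i (\<lambda>y. f y $ j) x)"

text \<open>Derivative of a function along a vector field given by its components.\<close>

definition lie :: "(('n::finite) cvec \<Rightarrow> 'n cvec) \<Rightarrow> ('n cvec \<Rightarrow> complex) \<Rightarrow> 'n cvec \<Rightarrow> complex"
  where "lie Z f x = (\<Sum>k\<in>UNIV. Z x $ k * pd k f x)"

definition diag_mat :: "('n::finite \<Rightarrow> complex) \<Rightarrow> 'n cmat"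
  where "diag_mat f = (\<chi> i j. if i = j then f i else 0)"


section \<open>Complex reflection groups, basic invariants, branch locus\<close>

definition GL :: "(('n::finite) cmat) monoid"
  where "GL = \<lparr>carrier = {A. invertible A}, monoid.mult = (**), one = mat 1\<rparr>"

definition is_reflection :: "('n::finite) cmat \<Rightarrow> bool"
  where "is_reflection g \<longleftrightarrow> vec.dim {v. g *v v = v} = CARD('n) - 1"

definition complex_reflection_group :: "(('n::finite) cmat) set \<Rightarrow> bool"
  where "complex_reflection_group G \<longleftrightarrow> subgroup G GL \<and> finite G \<and>
           generate GL {g \<in> G. is_reflection g} = G"

definition irreducible_group :: "(('n::finite) cmat) set \<Rightarrow> bool"
  where "irreducible_group G \<longleftrightarrow>
           (\<forall>W. vec.subspace W \<and> (\<forall>g\<in>G. \<forall>v\<in>W. g *v v \<in> W) \<longrightarrow> W = {0} \<or> W = UNIV)"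

definition well_generated :: "(('n::finite) cmat) set \<Rightarrow> bool"
  where "well_generated G \<longleftrightarrow>
           (\<exists>S \<subseteq> G. card S = CARD('n) \<and> (\<forall>g\<in>S. is_reflection g) \<and> generate GL S = G)"

definition invariant_under :: "(('n::finite) cmat) set \<Rightarrow> ('n cvec \<Rightarrow> complex) \<Rightarrow> bool"
  where "invariant_under G f \<longleftrightarrow> (\<forall>g\<in>G. \<forall>u. f (g *v u) = f u)"

text \<open>
  \<open>F u $ i\<close> is \<open>F\<^sub>i(u)\<close>, so \<open>F\<close> is also the quotient map \<open>U\<^sub>n \<rightarrow> X\<close> in the coordinates \<open>x\<^sub>i = F\<^sub>i\<close>.
\<close>

definition basic_invariants ::
    "(('n::{finite,linorder}) cmat) set \<Rightarrow> ('n \<Rightarrow> nat) \<Rightarrow> ('n cvec \<Rightarrow> 'n cvec) \<Rightarrow> bool"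
  where "basic_invariants G d F \<longleftrightarrow>
     mono d \<and>
     (\<forall>i. homogeneous_poly (d i) (\<lambda>u. F u $ i) \<and> invariant_under G (\<lambda>u. F u $ i)) \<and>
     (\<forall>p. is_poly p \<and> (\<forall>u. p (F u) = 0) \<longrightarrow> p = (\<lambda>_. 0)) \<and>
     (\<forall>f. is_poly f \<and> invariant_under G f \<longrightarrow> (\<exists>p. is_poly p \<and> (\<forall>u. f u = p (F u))))"

text \<open>The quotient map is branched exactly over the orbits of points with nontrivial stabilizer.\<close>

definition branch_locus ::
    "(('n::finite) cmat) set \<Rightarrow> ('n cvec \<Rightarrow> 'n cvec) \<Rightarrow> ('n cvec) set"
  where "branch_locus G F = {F u |u. \<exists>g\<in>G. g \<noteq> mat 1 \<and> g *v u = u}"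

definition branch_polynomial ::
    "(('n::{finite,linorder}) cmat) set \<Rightarrow> ('n cvec \<Rightarrow> 'n cvec) \<Rightarrow>
     ('n cvec \<Rightarrow> complex) \<Rightarrow> bool"
  where "branch_polynomial G F h \<longleftrightarrow>
     is_poly h \<and> {x. h x = 0} = branch_locus G F \<and>
     (\<forall>p q. is_poly p \<and> is_poly q \<and> h = (\<lambda>x. p x ^ 2 * q x) \<longrightarrow> (\<exists>c. p = (\<lambda>_. c))) \<and>
     (\<exists>a. (\<forall>k. poly_fun xprime (a k)) \<and>
          h = (\<lambda>x. x $ last_ix ^ CARD('n) + (\<Sum>k<CARD('n). a k x * x $ last_ix ^ k)))"

definition wt :: "('n::{finite,linorder} \<Rightarrow> nat) \<Rightarrow> 'n \<Rightarrow> real"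
  where "wt d i = real (d i) / real (d last_ix)"


section \<open>The vector fields\<close>

text \<open>
  The \<open>z\<^sub>i\<^sup>0(x')\<close> are multivalued. A local branch is a system of holomorphic functions \<open>z\<^sub>i\<^sup>0\<close> not
  depending on \<open>x\<^sub>n\<close>, on an open set that is a cylinder in the direction of \<open>x\<^sub>n\<close>, whose values are
  the roots of \<open>h\<close> as a polynomial in \<open>x\<^sub>n\<close>. All matrices below are taken along a local branch;
  another branch changes \<open>P\<^sub>h\<close> only by a permutation of its columns.
\<close>

definition local_roots ::
    "(('n::{finite,linorder}) cvec \<Rightarrow> complex) \<Rightarrow> ('n cvec) set \<Rightarrow>
     ('n \<Rightarrow> 'n cvec \<Rightarrow> complex) \<Rightarrow> bool"
  where "local_roots h W z0 \<longleftrightarrow>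
     open W \<and> (\<forall>i. holo_on (z0 i) W) \<and>
     (\<forall>x\<in>W. \<forall>s. upd x last_ix s \<in> W \<and> (\<forall>i. z0 i (upd x last_ix s) = z0 i x)) \<and>
     (\<forall>x\<in>W. h x = (\<Prod>i\<in>UNIV. x $ last_ix - z0 i x))"

definition zvec :: "('n::{finite,linorder} \<Rightarrow> 'n cvec \<Rightarrow> complex) \<Rightarrow> 'n cvec \<Rightarrow> 'n cvec"
  where "zvec z0 x = (\<chi> i. z0 i x - x $ last_ix)"

definition P_h :: "('n::{finite,linorder} \<Rightarrow> 'n cvec \<Rightarrow> complex) \<Rightarrow> 'n cvec \<Rightarrow> 'n cmat"
  where "P_h z0 x = jacobian (zvec z0) x"

definition M_V :: "('n::{finite,linorder} \<Rightarrow> 'n cvec \<Rightarrow> complex) \<Rightarrow> 'n cvec \<Rightarrow> 'n cmat"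
  where "M_V z0 x = - (P_h z0 x ** diag_mat (\<lambda>i. zvec z0 x $ i) ** matrix_inv (P_h z0 x))"

definition M_Vt ::
    "(('n::{finite,linorder}) cvec \<Rightarrow> 'n cvec) \<Rightarrow> ('n \<Rightarrow> 'n cvec \<Rightarrow> complex) \<Rightarrow>
     'n cvec \<Rightarrow> 'n cmat"
  where "M_Vt F z0 u = M_V z0 (F u) ** matrix_inv (jacobian F u)"

text \<open>The column vector of the derivatives of \<open>y\<close> along the pulled-back fields, indices descending from \<open>n\<close> to \<open>1\<close>.\<close>

definition Vt_apply ::
    "(('n::{finite,linorder}) cvec \<Rightarrow> 'n cvec) \<Rightarrow> ('n \<Rightarrow> 'n cvec \<Rightarrow> complex) \<Rightarrow>
     ('n cvec \<Rightarrow> complex) \<Rightarrow> 'n cvec \<Rightarrow> 'n cvec"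
  where "Vt_apply F z0 y u = M_Vt F z0 u *v (\<chi> a. pd a y u)"


section \<open>The G-quotient system\<close>

definition B_inf :: "('n::{finite,linorder} \<Rightarrow> nat) \<Rightarrow> 'n cmat"
  where "B_inf d = diag_mat (\<lambda>i. of_real (wt d i - (1 + 1 / real (d last_ix))))"

definition Y_vec ::
    "('n::{finite,linorder} \<Rightarrow> nat) \<Rightarrow> ('n cvec \<Rightarrow> 'n cvec) \<Rightarrow>
     ('n cvec \<Rightarrow> 'n cmat) \<Rightarrow> ('n \<Rightarrow> 'n cvec \<Rightarrow> complex) \<Rightarrow>
     ('n cvec \<Rightarrow> complex) \<Rightarrow> 'n cvec \<Rightarrow> 'n cvec"
  where "Y_vec d F R z0 y u = - ((matrix_inv (B_inf d) ** R (F u)) *v Vt_apply F z0 y u)"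

definition T_mat :: "(('n::{finite,linorder}) cvec \<Rightarrow> 'n cmat) \<Rightarrow> 'n cvec \<Rightarrow> 'n cmat"
  where "T_mat T0 x = T0 x - diag_mat (\<lambda>_. x $ last_ix)"

text \<open>The value at \<open>x\<close> of the matrix of 1-forms \<open>\<Sum>\<^sub>k B\<^sup>k dx\<^sub>k\<close> on the tangent vector \<open>v\<close>.\<close>

definition Omega ::
    "('n::finite \<Rightarrow> 'n cvec \<Rightarrow> 'n cmat) \<Rightarrow> 'n cvec \<Rightarrow> 'n cvec \<Rightarrow> 'n cmat"
  where "Omega B x v = (\<chi> i j. \<Sum>k\<in>UNIV. v $ k * B k x $ i $ j)"

text \<open>
  The four integrability conditions, on the coefficients of \<open>dx\<^sub>k\<close> and \<open>dx\<^sub>k \<and> dx\<^sub>l\<close>.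
\<close>

definition okubo_integrable ::
    "'n cmat \<Rightarrow> ('n cvec \<Rightarrow> 'n cmat) \<Rightarrow>
     ('n::finite \<Rightarrow> 'n cvec \<Rightarrow> 'n cmat) \<Rightarrow> bool"
  where "okubo_integrable Binf T B \<longleftrightarrow>
     (\<forall>x k. T x ** B k x = B k x ** T x) \<and>
     (\<forall>x k l. B k x ** B l x = B l x ** B k x) \<and>
     (\<forall>x k. (\<chi> i j. pd k (\<lambda>y. T y $ i $ j) x) + B k x + (B k x ** Binf - Binf ** B k x) = 0) \<and>
     (\<forall>x k l i j. pd k (\<lambda>y. B l y $ i $ j) x = pd l (\<lambda>y. B k y $ i $ j) x)"

definition normalizing_matrix ::
    "('n::{finite,linorder} \<Rightarrow> nat) \<Rightarrow> ('n cvec \<Rightarrow> 'n cmat) \<Rightarrow> bool"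
  where "normalizing_matrix d R \<longleftrightarrow>
     (\<forall>i j. poly_fun (xprime \<inter> weight_exps (wt d) (wt d j - wt d i)) (\<lambda>x. R x $ i $ j)) \<and>
     (\<exists>S. (\<forall>i j. poly_fun xprime (\<lambda>x. S x $ i $ j)) \<and>
          (\<forall>x. R x ** S x = mat 1 \<and> S x ** R x = mat 1)) \<and>
     (\<forall>x i j. j < i \<longrightarrow> R x $ i $ j = 0) \<and> R 0 = mat 1"

text \<open>
  The differential equation for \<open>Y\<close> is an identity of 1-forms on \<open>U\<^sub>n\<close>: the tangent vector \<open>v\<close> at \<open>u\<close>
  is mapped to \<open>v v* jacobian F u\<close> at \<open>F u\<close>. It is required wherever \<open>P\<^sub>h\<close>, \<open>\<partial>x/\<partial>u\<close> and \<open>T\<close> are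
  invertible.
\<close>

definition G_quotient_system ::
    "(('n::{finite,linorder}) cmat) set \<Rightarrow> ('n \<Rightarrow> nat) \<Rightarrow> ('n cvec \<Rightarrow> 'n cvec) \<Rightarrow>
     ('n cvec \<Rightarrow> complex) \<Rightarrow> ('n cvec \<Rightarrow> 'n cmat) \<Rightarrow>
     ('n \<Rightarrow> 'n cvec \<Rightarrow> 'n cmat) \<Rightarrow> bool"
  where "G_quotient_system G d F h T0 B \<longleftrightarrow>
     (\<forall>i j. poly_fun xprime (\<lambda>x. T0 x $ i $ j)) \<and>
     (\<forall>k i j. poly_fun xprime (\<lambda>x. B k x $ i $ j)) \<and>
     B last_ix = (\<lambda>_. mat 1) \<and>
     okubo_integrable (B_inf d) (T_mat T0) B \<and>
     (\<exists>R. normalizing_matrix d R \<and>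
        (\<forall>W z0 y u. local_roots h W z0 \<and> homogeneous_poly 1 y \<and>
            F u \<in> W \<and> F u \<notin> branch_locus G F \<and>
            invertible (P_h z0 (F u)) \<and> invertible (T_mat T0 (F u)) \<longrightarrow>
          (Y_vec d F R z0 y has_derivative
             (\<lambda>v. (matrix_inv (T_mat T0 (F u)) ** Omega B (F u) (v v* jacobian F u) ** B_inf d)
                    *v Y_vec d F R z0 y u)) (at u)))"


section \<open>The induced Saito structure\<close>

text \<open>
  \<open>\<phi>\<close> at the point \<open>x\<close>; a vector field is given by its components with respect to \<open>\<partial>/\<partial>x\<^sub>k\<close>.
\<close>

definition phi ::
    "('n::{finite,linorder} \<Rightarrow> 'n cvec \<Rightarrow> 'n cmat) \<Rightarrow> 'n cvec \<Rightarrow> 'n cvec \<Rightarrow> 'n cvec"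
  where "phi B x v = transpose (Omega B x v) *v axis last_ix 1"

definition phi_isomorphism :: "('n::{finite,linorder} \<Rightarrow> 'n cvec \<Rightarrow> 'n cmat) \<Rightarrow> bool"
  where "phi_isomorphism B \<longleftrightarrow> (\<forall>x. bij (phi B x))"

text \<open>\<open>nabla0 B v Z x\<close> is the covariant derivative at \<open>x\<close> of the vector field \<open>Z\<close> along the tangent vector \<open>v\<close>.\<close>

definition nabla0 ::
    "('n::{finite,linorder} \<Rightarrow> 'n cvec \<Rightarrow> 'n cmat) \<Rightarrow> 'n cvec \<Rightarrow>
     ('n cvec \<Rightarrow> 'n cvec) \<Rightarrow> 'n cvec \<Rightarrow> 'n cvec"
  where "nabla0 B v Z x = inv_into UNIV (phi B x) (\<chi> j. lie (\<lambda>_. v) (\<lambda>y. phi B y (Z y) $ j) x)"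

definition Phi ::
    "('n::{finite,linorder} \<Rightarrow> 'n cvec \<Rightarrow> 'n cmat) \<Rightarrow> 'n cvec \<Rightarrow>
     'n cvec \<Rightarrow> 'n cvec \<Rightarrow> 'n cvec"
  where "Phi B x v w = inv_into UNIV (phi B x) (transpose (Omega B x v) *v phi B x w)"

definition unit_field ::
    "('n::{finite,linorder} \<Rightarrow> 'n cvec \<Rightarrow> 'n cmat) \<Rightarrow> 'n cvec \<Rightarrow> 'n cvec"
  where "unit_field B x = inv_into UNIV (phi B x) (axis last_ix 1)"

definition euler_field ::
    "('n cvec \<Rightarrow> 'n cmat) \<Rightarrow> ('n::{finite,linorder} \<Rightarrow> 'n cvec \<Rightarrow> 'n cmat) \<Rightarrow>
     'n cvec \<Rightarrow> 'n cvec"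
  where "euler_field T0 B x = - inv_into UNIV (phi B x) (transpose (T_mat T0 x) *v axis last_ix 1)"


section \<open>Flat basic invariants\<close>

text \<open>
  \<open>t\<close> is the map \<open>x \<mapsto> (t\<^sub>1, ..., t\<^sub>n)\<close> obtained by writing \<open>t\<^sub>i = Ffl\<^sub>i(u)\<close> as a polynomial in \<open>x = F(u)\<close>.
\<close>

definition coordinates_on_X ::
    "(('n::finite) cvec \<Rightarrow> 'n cvec) \<Rightarrow> ('n cvec \<Rightarrow> 'n cvec) \<Rightarrow>
     ('n cvec \<Rightarrow> 'n cvec) \<Rightarrow> bool"
  where "coordinates_on_X F Ffl t \<longleftrightarrow> (\<forall>i. is_poly (\<lambda>x. t x $ i)) \<and> (\<forall>u. t (F u) = Ffl u)"

text \<open>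
  The vector field \<open>\<partial>/\<partial>t\<^sub>i\<close>: row \<open>i\<close> of \<open>(\<partial>x\<^sub>k/\<partial>t\<^sub>i)\<^bsub>i,k\<^esub>\<close>, the inverse of \<open>(\<partial>t\<^sub>j/\<partial>x\<^sub>k)\<^bsub>k,j\<^esub>\<close>.
\<close>

definition d_t :: "(('n::finite) cvec \<Rightarrow> 'n cvec) \<Rightarrow> 'n \<Rightarrow> 'n cvec \<Rightarrow> 'n cvec"
  where "d_t t i x = matrix_inv (jacobian t x) $ i"

definition flat_basic_invariants ::
    "(('n::{finite,linorder}) cmat) set \<Rightarrow> ('n \<Rightarrow> nat) \<Rightarrow> ('n cvec \<Rightarrow> 'n cvec) \<Rightarrow>
     ('n cvec \<Rightarrow> 'n cmat) \<Rightarrow> ('n \<Rightarrow> 'n cvec \<Rightarrow> 'n cmat) \<Rightarrow>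
     ('n cvec \<Rightarrow> 'n cvec) \<Rightarrow> ('n cvec \<Rightarrow> 'n cvec) \<Rightarrow> bool"
  where "flat_basic_invariants G d F T0 B Ffl t \<longleftrightarrow>
     basic_invariants G d Ffl \<and> coordinates_on_X F Ffl t \<and>
     (\<forall>x v i. nabla0 B v (d_t t i) x = 0) \<and>
     (\<forall>x. unit_field B x = d_t t last_ix x) \<and>
     (\<forall>x. euler_field T0 B x = (\<Sum>i\<in>UNIV. (of_real (wt d i) * t x $ i) *s d_t t i x))"


section \<open>The potential vector field\<close>

definition potential_vector_field ::
    "('n::{finite,linorder} \<Rightarrow> nat) \<Rightarrow> ('n cvec \<Rightarrow> 'n cmat) \<Rightarrow>
     ('n \<Rightarrow> 'n cvec \<Rightarrow> 'n cmat) \<Rightarrow> ('n cvec \<Rightarrow> 'n cvec) \<Rightarrow>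
     ('n \<Rightarrow> 'n cvec \<Rightarrow> complex) \<Rightarrow> bool"
  where "potential_vector_field d T0 B t g \<longleftrightarrow> (\<exists>\<T> \<C>.
     (\<forall>x j. - Phi B x (d_t t j x) (euler_field T0 B x) = (\<Sum>i\<in>UNIV. \<T> x $ j $ i *s d_t t i x)) \<and>
     (\<forall>i j. holo_on (\<lambda>x. \<C> x $ i $ j) UNIV) \<and>
     (\<forall>x i j. \<T> x $ i $ j = - lie (euler_field T0 B) (\<lambda>y. \<C> y $ i $ j) x) \<and>
     (\<forall>x i j. lie (euler_field T0 B) (\<lambda>y. \<C> y $ i $ j) x
                = of_real (1 - wt d i + wt d j) * \<C> x $ i $ j) \<and>
     (\<forall>j. holo_on (g j) UNIV) \<and>
     (\<forall>x i j. \<C> x $ i $ j = lie (d_t t i) (g j) x) \<and>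
     (\<forall>x j. lie (euler_field T0 B) (g j) x = of_real (1 + wt d j) * g j x))"

end

theory Submission
  imports Defs
begin

text \<open>
  Since \<open>F\<close> and \<open>Ffl\<close> both freely generate the ring of invariants, \<open>t\<close> is a polynomial automorphism,
  so the fields \<open>\<partial>/\<partial>t\<^sub>i\<close> have polynomial components. Flatness makes the vectors \<open>\<phi>(\<partial>/\<partial>t\<^sub>i)\<close> constant;
  in this constant frame the entries of \<open>\<T>\<close> are polynomial without inverting \<open>\<phi>\<close>. As \<open>w\<^sub>i \<le> 1\<close> and
  \<open>w\<^sub>j > 0\<close>, the factor \<open>1 - w\<^sub>i + w\<^sub>j\<close> is nonzero, and homogeneity turns \<open>\<T> = -E \<C>\<close> and
  \<open>E g\<^sub>j = (1 + w\<^sub>j) g\<^sub>j\<close> into algebraic formulas for \<open>\<C>\<close> and then for \<open>g\<^sub>j\<close>.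
\<close>

section \<open>Polynomial functions\<close>

lemma poly_fun_mono: "poly_fun S f \<Longrightarrow> S \<subseteq> S' \<Longrightarrow> poly_fun S' f"
  unfolding poly_fun_def by blast

lemma poly_fun_is_poly: "poly_fun S f \<Longrightarrow> is_poly f"
  by (rule poly_fun_mono) auto

lemma is_poly_monomial: "is_poly (\<lambda>x. c * (\<Prod>i\<in>UNIV. x $ i ^ \<alpha> i))"
  unfolding poly_fun_def by (rule exI[of _ "{\<alpha>}"], rule exI[of _ "\<lambda>_. c"]) simp

lemma is_poly_const [simp, intro]: "is_poly (\<lambda>x. c)"
  using is_poly_monomial[of c "\<lambda>_. 0"] by simp

lemma is_poly_coord [simp, intro]: "is_poly (\<lambda>x. x $ k)"
proof -
  have "(\<Prod>i\<in>UNIV. x $ i ^ (if i = k then 1 else 0)) = x $ k" for x :: "'a::finite cvec"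
    by (simp add: if_distrib[of "\<lambda>n. _ ^ n"] cong: if_cong)
  then show ?thesis
    using is_poly_monomial[of 1 "\<lambda>i. if i = k then 1 else 0"] by simp
qed

lemma is_poly_add [intro]:
  assumes "is_poly f" "is_poly g"
  shows "is_poly (\<lambda>x. f x + g x)"
proof -
  obtain M c where M: "finite M" "f = (\<lambda>x. \<Sum>\<alpha>\<in>M. c \<alpha> * (\<Prod>i\<in>UNIV. x $ i ^ \<alpha> i))"
    using assms(1) unfolding poly_fun_def by blast
  obtain N e where N: "finite N" "g = (\<lambda>x. \<Sum>\<alpha>\<in>N. e \<alpha> * (\<Prod>i\<in>UNIV. x $ i ^ \<alpha> i))"
    using assms(2) unfolding poly_fun_def by blast
  let ?c = "\<lambda>\<alpha>. (if \<alpha> \<in> M then c \<alpha> else 0) + (if \<alpha> \<in> N then e \<alpha> else 0)"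
  have "f x + g x = (\<Sum>\<alpha>\<in>M \<union> N. ?c \<alpha> * (\<Prod>i\<in>UNIV. x $ i ^ \<alpha> i))" for x
  proof -
    have "f x = (\<Sum>\<alpha>\<in>M \<union> N. (if \<alpha> \<in> M then c \<alpha> else 0) * (\<Prod>i\<in>UNIV. x $ i ^ \<alpha> i))"
      unfolding M(2) using M(1) N(1) by (intro sum.mono_neutral_cong_left) auto
    moreover have "g x = (\<Sum>\<alpha>\<in>M \<union> N. (if \<alpha> \<in> N then e \<alpha> else 0) * (\<Prod>i\<in>UNIV. x $ i ^ \<alpha> i))"
      unfolding N(2) using M(1) N(1) by (intro sum.mono_neutral_cong_left) auto
    ultimately show ?thesis
      by (simp only: distrib_right sum.distrib)
  qed
  then show ?thesis
    unfolding poly_fun_def using M(1) N(1)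
    by (intro exI[of _ "M \<union> N"] exI[of _ ?c]) auto
qed

lemma is_poly_sum [intro]:
  assumes "\<And>a. a \<in> A \<Longrightarrow> is_poly (f a)"
  shows "is_poly (\<lambda>x. \<Sum>a\<in>A. f a x)"
  using assms by (induction A rule: infinite_finite_induct) auto

lemma is_poly_mult [intro]:
  assumes "is_poly f" "is_poly g"
  shows "is_poly (\<lambda>x. f x * g x)"
proof -
  obtain M c where M: "f = (\<lambda>x. \<Sum>\<alpha>\<in>M. c \<alpha> * (\<Prod>i\<in>UNIV. x $ i ^ \<alpha> i))"
    using assms(1) unfolding poly_fun_def by blast
  obtain N e where N: "g = (\<lambda>x. \<Sum>\<alpha>\<in>N. e \<alpha> * (\<Prod>i\<in>UNIV. x $ i ^ \<alpha> i))"
    using assms(2) unfolding poly_fun_def by blast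
  have "f x * g x = (\<Sum>\<alpha>\<in>M. \<Sum>\<beta>\<in>N. (c \<alpha> * e \<beta>) * (\<Prod>i\<in>UNIV. x $ i ^ (\<alpha> i + \<beta> i)))" for x
    unfolding M N sum_product by (simp add: power_add prod.distrib mult_ac)
  then show ?thesis
    by (auto intro!: is_poly_sum is_poly_monomial)
qed

lemma is_poly_uminus [intro]: "is_poly f \<Longrightarrow> is_poly (\<lambda>x. - f x)"
  using is_poly_mult[OF is_poly_const[of "-1"]] by force

lemma is_poly_diff [intro]: "is_poly f \<Longrightarrow> is_poly g \<Longrightarrow> is_poly (\<lambda>x. f x - g x)"
  using is_poly_add[OF _ is_poly_uminus] by force

lemma is_poly_prod [intro]:
  assumes "\<And>a. a \<in> A \<Longrightarrow> is_poly (f a)"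
  shows "is_poly (\<lambda>x. \<Prod>a\<in>A. f a x)"
  using assms by (induction A rule: infinite_finite_induct) auto

lemma is_poly_power [intro]: "is_poly f \<Longrightarrow> is_poly (\<lambda>x. f x ^ n)"
  by (induction n) auto

lemma is_poly_compose:
  assumes "is_poly p" "\<And>i. is_poly (\<lambda>x. f x $ i)"
  shows "is_poly (\<lambda>x. p (f x))"
proof -
  obtain M c where "p = (\<lambda>x. \<Sum>\<alpha>\<in>M. c \<alpha> * (\<Prod>i\<in>UNIV. x $ i ^ \<alpha> i))"
    using assms(1) unfolding poly_fun_def by blast
  then show ?thesis
    using assms(2) by (auto intro!: is_poly_sum is_poly_mult is_poly_prod is_poly_power)
qed

lemma is_poly_induct [consumes 1, case_names const coord add mult]:
  assumes "is_poly f"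
    and const: "\<And>c. P (\<lambda>x. c)"
    and coord: "\<And>k. P (\<lambda>x. x $ k)"
    and add: "\<And>f g. P f \<Longrightarrow> P g \<Longrightarrow> P (\<lambda>x. f x + g x)"
    and mult: "\<And>f g. P f \<Longrightarrow> P g \<Longrightarrow> P (\<lambda>x. f x * g x)"
  shows "P f"
proof -
  have pow: "P (\<lambda>x. x $ i ^ k)" for i k
    by (induction k) (auto intro: const mult coord)
  have prod: "P (\<lambda>x. \<Prod>i\<in>A. x $ i ^ \<alpha> i)" if "finite A" for A and \<alpha> :: "'a \<Rightarrow> nat"
    using that by (induction A) (auto intro: const mult pow)
  have sum: "P (\<lambda>x. \<Sum>\<alpha>\<in>M. c \<alpha> * (\<Prod>i\<in>UNIV. x $ i ^ \<alpha> i))"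
    if "finite M" for M and c :: "('a \<Rightarrow> nat) \<Rightarrow> complex"
    using that
  proof (induction M)
    case (insert \<alpha> M)
    show ?case
      using add[OF mult[OF const prod[OF finite]] insert.IH] insert.hyps by simp
  qed (simp add: const)
  show ?thesis
    using assms(1) sum unfolding poly_fun_def by blast
qed

section \<open>Partial derivatives\<close>

lemma upd_has_derivative: "((\<lambda>s. upd x i s) has_derivative (\<lambda>h. axis i h)) F"
proof -
  have upd: "upd x i = (\<lambda>s. upd x i 0 + axis i s)"
    by (auto simp: upd_def axis_def vec_eq_iff)
  have "bounded_linear (axis i :: complex \<Rightarrow> complex ^ 'a)"
    unfolding linear_conv_bounded_linear[symmetric]
    by (intro linearI) (auto simp: axis_def vec_eq_iff)
  then have "(axis i has_derivative axis i) F"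
    by (rule bounded_linear_imp_has_derivative)
  from has_derivative_add[OF has_derivative_const this, of "upd x i 0"] show ?thesis
    unfolding upd[symmetric] by simp
qed

lemma pd_eq:
  assumes "(f has_derivative (\<lambda>v. \<Sum>i\<in>UNIV. D i * v $ i)) (at x)"
  shows "pd k f x = D k"
proof -
  have "upd x k (x $ k) = x"
    by (auto simp: upd_def vec_eq_iff)
  then have "((\<lambda>s. f (upd x k s)) has_derivative (\<lambda>h. \<Sum>i\<in>UNIV. D i * axis k h $ i)) (at (x $ k))"
    using has_derivative_compose[OF upd_has_derivative, of f _ x k "x $ k" UNIV] assms by simp
  then have "((\<lambda>s. f (upd x k s)) has_derivative (\<lambda>h. D k * h)) (at (x $ k))"
    by (simp add: axis_def if_distrib[of "\<lambda>y. _ * y"] cong: if_cong)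
  then show ?thesis
    unfolding pd_def by (intro DERIV_imp_deriv) (simp add: has_field_derivative_def)
qed

lemma is_poly_has_derivative_ex:
  assumes "is_poly f"
  shows "is_poly f \<and> (\<exists>D. (\<forall>i. is_poly (D i)) \<and>
           (\<forall>x. (f has_derivative (\<lambda>v. \<Sum>i\<in>UNIV. D i x * v $ i)) (at x)))"
  using assms
proof (induction f rule: is_poly_induct)
  case (const c)
  show ?case
    by (intro conjI exI[of _ "\<lambda>_ _. 0"]) auto
next
  case (coord k)
  have "(\<Sum>i\<in>UNIV. (if i = k then 1 else 0) * v $ i) = v $ k" for v :: "'a cvec"
    by (simp add: if_distrib[of "\<lambda>y. y * _"] cong: if_cong)
  then show ?case
    by (intro conjI exI[of _ "\<lambda>i _. if i = k then 1 else 0"])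
       (auto intro!: bounded_linear.has_derivative[OF bounded_linear_vec_nth] has_derivative_ident)
next
  case (add f g)
  then obtain D E where DE: "\<And>i. is_poly (D i)" "\<And>i. is_poly (E i)"
    "\<And>x. (f has_derivative (\<lambda>v. \<Sum>i\<in>UNIV. D i x * v $ i)) (at x)"
    "\<And>x. (g has_derivative (\<lambda>v. \<Sum>i\<in>UNIV. E i x * v $ i)) (at x)"
    by blast
  have deriv: "((\<lambda>x. f x + g x) has_derivative (\<lambda>v. \<Sum>i\<in>UNIV. (D i x + E i x) * v $ i)) (at x)" for x
    using has_derivative_add[OF DE(3,4), of x] by (simp add: distrib_right sum.distrib)
  have poly: "is_poly (\<lambda>x. D i x + E i x)" "is_poly (\<lambda>x. f x + g x)" for i
    using DE(1,2) add by (auto intro!: is_poly_add)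
  show ?case
    by (intro conjI exI[of _ "\<lambda>i x. D i x + E i x"] allI poly deriv)
next
  case (mult f g)
  then obtain D E where DE: "\<And>i. is_poly (D i)" "\<And>i. is_poly (E i)"
    "\<And>x. (f has_derivative (\<lambda>v. \<Sum>i\<in>UNIV. D i x * v $ i)) (at x)"
    "\<And>x. (g has_derivative (\<lambda>v. \<Sum>i\<in>UNIV. E i x * v $ i)) (at x)"
    by blast
  have "(\<Sum>i\<in>UNIV. (f x * E i x + D i x * g x) * v $ i) =
        f x * (\<Sum>i\<in>UNIV. E i x * v $ i) + (\<Sum>i\<in>UNIV. D i x * v $ i) * g x" for x v
    by (simp add: algebra_simps sum.distrib sum_distrib_left)
  then have deriv: "((\<lambda>x. f x * g x) has_derivative
      (\<lambda>v. \<Sum>i\<in>UNIV. (f x * E i x + D i x * g x) * v $ i)) (at x)" for x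
    using has_derivative_mult[OF DE(3,4), of x] by simp
  have poly: "is_poly (\<lambda>x. f x * E i x + D i x * g x)" "is_poly (\<lambda>x. f x * g x)" for i
    using DE(1,2) mult by (auto intro!: is_poly_add is_poly_mult)
  show ?case
    by (intro conjI exI[of _ "\<lambda>i x. f x * E i x + D i x * g x"] allI poly deriv)
qed

lemma
  assumes "is_poly f"
  shows is_poly_has_derivative: "(f has_derivative (\<lambda>v. \<Sum>i\<in>UNIV. pd i f x * v $ i)) (at x)"
    and is_poly_pd: "is_poly (pd k f)"
proof -
  obtain D where D: "\<And>i. is_poly (D i)"
    "\<And>x. (f has_derivative (\<lambda>v. \<Sum>i\<in>UNIV. D i x * v $ i)) (at x)"
    using is_poly_has_derivative_ex[OF assms] by blast
  then have "pd i f = D i" for i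
    using pd_eq[OF D(2)] by blast
  then show "(f has_derivative (\<lambda>v. \<Sum>i\<in>UNIV. pd i f x * v $ i)) (at x)" "is_poly (pd k f)"
    using D by auto
qed

lemma is_poly_constant:
  assumes "is_poly f" "\<And>k x. pd k f x = 0"
  shows "f x = f y"
proof -
  have "(f has_derivative (\<lambda>v. 0)) (at x)" for x
    using is_poly_has_derivative[OF assms(1), of x] assms(2) by simp
  then show ?thesis
    using has_derivative_zero_constant[of UNIV f] by (metis UNIV_I convex_UNIV)
qed

lemma jacobian_chain:
  assumes "\<And>i. is_poly (\<lambda>x. f x $ i)" "\<And>i. is_poly (\<lambda>x. g x $ i)"
  shows "jacobian (\<lambda>x. g (f x)) x = jacobian f x ** jacobian g (f x)"
proof -
  have f: "(f has_derivative (\<lambda>v. \<chi> i. \<Sum>k\<in>UNIV. pd k (\<lambda>x. f x $ i) x * v $ k)) (at x)"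
    using is_poly_has_derivative[OF assms(1)]
    by (subst has_derivative_componentwise_within) (auto simp: Basis_vec_def inner_axis
        intro!: bounded_linear.has_derivative[OF bounded_linear_inner_left])
  have "((\<lambda>x. g (f x) $ j) has_derivative
          (\<lambda>v. \<Sum>i\<in>UNIV. pd i (\<lambda>x. g x $ j) (f x) * (\<Sum>k\<in>UNIV. pd k (\<lambda>x. f x $ i) x * v $ k))) (at x)"
    for j
    using has_derivative_compose[OF f is_poly_has_derivative[OF assms(2)]] by simp
  then have "((\<lambda>x. g (f x) $ j) has_derivative
          (\<lambda>v. \<Sum>k\<in>UNIV. (\<Sum>i\<in>UNIV. pd k (\<lambda>x. f x $ i) x * pd i (\<lambda>x. g x $ j) (f x)) * v $ k)) (at x)"
    for j
    unfolding sum_distrib_left sum_distrib_right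
    by (subst sum.swap) (simp add: mult_ac)
  from pd_eq[OF this] show ?thesis
    by (simp add: jacobian_def matrix_matrix_mult_def vec_eq_iff)
qed

lemma jacobian_id: "jacobian (\<lambda>x. x) x = mat 1"
proof -
  have "((\<lambda>x. x $ j) has_derivative (\<lambda>v. \<Sum>i\<in>UNIV. (if i = j then 1 else 0) * v $ i)) (at x)"
    for j :: 'a and x :: "'a cvec"
    by (auto intro!: bounded_linear.has_derivative[OF bounded_linear_vec_nth] has_derivative_ident
        simp: if_distrib[of "\<lambda>y. y * _"] cong: if_cong)
  from pd_eq[OF this] show ?thesis
    by (simp add: jacobian_def mat_def vec_eq_iff)
qed

section \<open>Coordinate changes between basic invariants\<close>

lemma basic_invariants_degree_pos:
  assumes "basic_invariants G d F"
  shows "d j > 0"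
proof (rule ccontr)
  assume "\<not> d j > 0"
  then have "homogeneous_poly 0 (\<lambda>u. F u $ j)"
    using assms unfolding basic_invariants_def by (metis gr0I)
  then obtain M c where M: "finite M" "M \<subseteq> weight_exps (\<lambda>_. 1) 0"
    "(\<lambda>u. F u $ j) = (\<lambda>x. \<Sum>\<alpha>\<in>M. c \<alpha> * (\<Prod>i\<in>UNIV. x $ i ^ \<alpha> i))"
    unfolding homogeneous_poly_def poly_fun_def by auto
  have "\<alpha> i = 0" if "\<alpha> \<in> M" for \<alpha> i
    using that M(2) by (auto simp: weight_exps_def sum_nonneg_eq_0_iff)
  then have term_eq: "c \<alpha> * (\<Prod>i\<in>UNIV. u $ i ^ \<alpha> i) = c \<alpha>" if "\<alpha> \<in> M" for \<alpha> u
    using that by (metis (no_types, lifting) mult.right_neutral power_0 prod.neutral)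
  have F: "F u $ j = (\<Sum>\<alpha>\<in>M. c \<alpha>)" for u
    by (rule trans[OF fun_cong[OF M(3)] sum.cong[OF refl term_eq]])
  define p where "p x = x $ j - (\<Sum>\<alpha>\<in>M. c \<alpha>)" for x
  have "is_poly p" "\<And>u. p (F u) = 0"
    unfolding p_def by (auto simp: F)
  then have "p = (\<lambda>_. 0)"
    using assms unfolding basic_invariants_def by blast
  from fun_cong[OF this, of "\<chi> i. (\<Sum>\<alpha>\<in>M. c \<alpha>) + 1"] show False
    by (simp add: p_def)
qed

lemma coordinates_on_X_inverse:
  assumes F: "basic_invariants G d F" and Ffl: "basic_invariants G d' Ffl"
    and t: "coordinates_on_X F Ffl t"
  obtains s where "\<And>i. is_poly (\<lambda>x. s x $ i)" "\<And>x. s (t x) = x"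
proof -
  have "\<exists>p. is_poly p \<and> (\<forall>u. F u $ i = p (Ffl u))" for i
  proof -
    have "is_poly (\<lambda>u. F u $ i)" "invariant_under G (\<lambda>u. F u $ i)"
      using F unfolding basic_invariants_def homogeneous_poly_def by (blast intro: poly_fun_is_poly)+
    then show ?thesis
      using Ffl unfolding basic_invariants_def by blast
  qed
  then obtain p where p: "\<And>i. is_poly (p i)" "\<And>i u. F u $ i = p i (Ffl u)"
    by metis
  define s where "s x = (\<chi> i. p i x)" for x
  have s: "is_poly (\<lambda>x. s x $ i)" for i
    using p(1) by (simp add: s_def)
  have t': "is_poly (\<lambda>x. t x $ i)" "t (F u) = Ffl u" for i u
    using t unfolding coordinates_on_X_def by auto
  have "is_poly (\<lambda>x. s (t x) $ i - x $ i)" for i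
    using is_poly_compose[OF s t'(1)] by auto
  moreover have "s (t (F u)) $ i - F u $ i = 0" for u i
    by (simp add: s_def t' p(2))
  ultimately have "(\<lambda>x. s (t x) $ i - x $ i) = (\<lambda>_. 0)" for i
    using F unfolding basic_invariants_def by meson
  then have "s (t x) = x" for x
    by (metis eq_iff_diff_eq_0 vec_eq_iff)
  with s that show ?thesis
    by blast
qed

lemma matrix_inv_eqI:
  fixes A :: "complex ^ 'n ^ 'n"
  assumes "A ** B = mat 1"
  shows "matrix_inv A = B"
proof -
  have "B ** A = mat 1"
    using assms matrix_left_right_inverse by blast
  with assms have "A ** matrix_inv A = mat 1"
    unfolding matrix_inv_def by (rule someI2[of _ B, OF conjI]) blast
  then show ?thesis
    by (metis \<open>B ** A = mat 1\<close> matrix_mul_assoc matrix_mul_lid matrix_mul_rid)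
qed

lemma
  assumes "\<And>i. is_poly (\<lambda>x. t x $ i)" "\<And>i. is_poly (\<lambda>x. s x $ i)" "\<And>x. s (t x) = x"
  shows invertible_jacobian: "invertible (jacobian t x)"
    and is_poly_d_t: "is_poly (\<lambda>x. d_t t i x $ k)"
proof -
  have 1: "jacobian t x ** jacobian s (t x) = mat 1" for x
    unfolding jacobian_chain[of t s x, OF assms(1,2), symmetric] assms(3) by (rule jacobian_id)
  then have 2: "jacobian s (t x) ** jacobian t x = mat 1" for x
    using matrix_left_right_inverse by blast
  show "invertible (jacobian t x)" for x
    using 1 2 invertible_def by blast
  have "matrix_inv (jacobian t x) = jacobian s (t x)" for x
    by (rule matrix_inv_eqI[OF 1])
  moreover have "is_poly (\<lambda>x. pd i (\<lambda>y. s y $ k) (t x))"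
    by (rule is_poly_compose[OF is_poly_pd[OF assms(2)] assms(1)])
  ultimately show "is_poly (\<lambda>x. d_t t i x $ k)"
    by (simp add: d_t_def jacobian_def)
qed

section \<open>The flat frame\<close>

lemma phi_eq: "phi B x v = v v* (\<chi> k l. B k x $ last_ix $ l)"
  by (simp add: phi_def Omega_def vector_matrix_mult_def matrix_vector_mult_def transpose_def
      axis_def vec_eq_iff if_distrib[of "\<lambda>y. _ * y"] cong: if_cong)

lemma phi_diff: "phi B x (v - w) = phi B x v - phi B x w"
  by (simp add: phi_eq vector_matrix_mult_def vec_eq_iff left_diff_distrib sum_subtractf)

lemma phi_0 [simp]: "phi B x 0 = 0"
  using phi_diff[of B x 0 0] by simp

lemma phi_uminus: "phi B x (- v) = - phi B x v"
  using phi_diff[of B x 0 v] by simp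

lemma phi_sum_scale: "phi B x (\<Sum>i\<in>UNIV. a i *s v i) = (\<Sum>i\<in>UNIV. a i *s phi B x (v i))"
proof -
  have "phi B x (\<Sum>i\<in>UNIV. a i *s v i) $ j = (\<Sum>i\<in>UNIV. a i *s phi B x (v i)) $ j" for j
    unfolding phi_eq vector_matrix_mult_def
    by (simp add: sum_distrib_left sum_distrib_right) (subst sum.swap, simp only: mult_ac)
  then show ?thesis
    by (simp add: vec_eq_iff)
qed

lemma invertible_of_bij_vector_matrix:
  fixes A :: "complex ^ 'n ^ 'n"
  assumes "bij (\<lambda>v. v v* A)"
  shows "invertible A"
proof -
  have "(*v) (transpose A) = (\<lambda>v. v v* A)"
    by (simp add: fun_eq_iff)
  then have "inj ((*v) (transpose A))"
    using bij_is_inj[OF assms] by simp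
  then show ?thesis
    by (metis invertible_right_inverse left_invertible_transpose matrix_left_invertible_injective)
qed

lemma flat_phi_constant:
  assumes bij: "phi_isomorphism B"
    and poly: "\<And>j. is_poly (\<lambda>x. phi B x (Z x) $ j)"
    and flat: "\<And>x v. nabla0 B v Z x = 0"
  shows "phi B x (Z x) = phi B y (Z y)"
proof -
  have "lie (\<lambda>_. v) (\<lambda>y. phi B y (Z y) $ j) x = 0" for v x j
  proof -
    have "surj (phi B x)"
      using bij unfolding phi_isomorphism_def by (metis bij_is_surj)
    from surj_f_inv_f[OF this, of "\<chi> j. lie (\<lambda>_. v) (\<lambda>y. phi B y (Z y) $ j) x"]
    have "(\<chi> j. lie (\<lambda>_. v) (\<lambda>y. phi B y (Z y) $ j) x) = 0"
      using flat[of v x] unfolding nabla0_def by simp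
    then show ?thesis
      by (simp add: vec_eq_iff)
  qed
  from this[of "axis _ 1"] have "pd k (\<lambda>y. phi B y (Z y) $ j) x = 0" for k x j
    by (simp add: lie_def axis_def if_distrib[of "\<lambda>y. y * _"] cong: if_cong)
  then have "phi B x (Z x) $ j = phi B y (Z y) $ j" for j
    by (rule is_poly_constant[OF poly])
  then show ?thesis
    by (simp add: vec_eq_iff)
qed

lemma lie_sum_scale:
  "lie (\<lambda>x. \<Sum>i\<in>UNIV. a i x *s Z i x) f x = (\<Sum>i\<in>UNIV. a i x * lie (Z i) f x)"
  unfolding lie_def
  by (simp add: sum_distrib_left sum_distrib_right) (subst sum.swap, simp only: mult_ac)

theorem corollary5p9:
  fixes G :: "(('n::{finite,linorder}) cmat) set"
    and d :: "'n \<Rightarrow> nat"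
    and F Ffl t :: "'n cvec \<Rightarrow> 'n cvec"
    and h :: "'n cvec \<Rightarrow> complex"
    and T0 :: "'n cvec \<Rightarrow> 'n cmat"
    and B :: "'n \<Rightarrow> 'n cvec \<Rightarrow> 'n cmat"
    and g :: "'n \<Rightarrow> 'n cvec \<Rightarrow> complex"
  assumes "complex_reflection_group G" and "irreducible_group G" and "well_generated G"
    and "basic_invariants G d F"
    and "branch_polynomial G F h"
    and "G_quotient_system G d F h T0 B"
    and "phi_isomorphism B"
    and "flat_basic_invariants G d F T0 B Ffl t"
    and "potential_vector_field d T0 B t g"
  shows "\<forall>j. \<exists>p. is_poly p \<and> (\<forall>x. g j x = p (t x))"
proof -
  have Ffl: "basic_invariants G d Ffl" and coord: "coordinates_on_X F Ffl t"
    and flat: "\<And>x v i. nabla0 B v (d_t t i) x = 0"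
    and euler: "euler_field T0 B = (\<lambda>x. \<Sum>i\<in>UNIV. (of_real (wt d i) * t x $ i) *s d_t t i x)"
    using assms(8) unfolding flat_basic_invariants_def by auto
  obtain \<T> \<C> where
    T: "\<And>x j. - Phi B x (d_t t j x) (euler_field T0 B x) = (\<Sum>i\<in>UNIV. \<T> x $ j $ i *s d_t t i x)"
    and TC: "\<And>x i j. \<T> x $ i $ j = - lie (euler_field T0 B) (\<lambda>y. \<C> y $ i $ j) x"
    and C_hom: "\<And>x i j. lie (euler_field T0 B) (\<lambda>y. \<C> y $ i $ j) x
                = of_real (1 - wt d i + wt d j) * \<C> x $ i $ j"
    and C_g: "\<And>x i j. \<C> x $ i $ j = lie (d_t t i) (g j) x"
    and g_hom: "\<And>x j. lie (euler_field T0 B) (g j) x = of_real (1 + wt d j) * g j x"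
    using assms(9) unfolding potential_vector_field_def by blast
  have B_poly: "is_poly (\<lambda>x. B k x $ i $ j)" for k i j
    using assms(6) unfolding G_quotient_system_def by (blast intro: poly_fun_is_poly)
  have t_poly: "is_poly (\<lambda>x. t x $ i)" for i
    using coord unfolding coordinates_on_X_def by blast
  obtain s where s_poly: "\<And>i. is_poly (\<lambda>x. s x $ i)" and st: "\<And>x. s (t x) = x"
    using coordinates_on_X_inverse[OF assms(4) Ffl coord] by blast
  have J_inv: "invertible (jacobian t x)" for x
    by (rule invertible_jacobian[OF t_poly s_poly st])
  have d_t_poly: "is_poly (\<lambda>x. d_t t i x $ k)" for i k
    by (rule is_poly_d_t[OF t_poly s_poly st])
  have phi_surj: "surj (phi B x)" for x
    using assms(7) unfolding phi_isomorphism_def by (metis bij_is_surj)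

  define c where "c i = phi B 0 (d_t t i 0)" for i
  have c: "phi B x (d_t t i x) = c i" for x i
    unfolding c_def
  proof (rule flat_phi_constant[OF assms(7) _ flat])
    show "is_poly (\<lambda>x. phi B x (d_t t i x) $ j)" for j
      by (auto simp: phi_eq vector_matrix_mult_def intro!: is_poly_sum is_poly_mult d_t_poly B_poly)
  qed
  define P where "P = (\<chi> k l. B k 0 $ last_ix $ l)"
  have "invertible P"
    using assms(7) unfolding phi_isomorphism_def P_def
    by (intro invertible_of_bij_vector_matrix) (metis (no_types, lifting) phi_eq ext)
  then have "invertible (matrix_inv (jacobian t 0) ** P)"
    using J_inv[of 0] by (metis invertible_def invertible_mult matrix_inv_eqI)
  moreover have "matrix_inv (jacobian t 0) ** P = (\<chi> i. c i)"
    by (simp add: c_def phi_eq P_def d_t_def vec_eq_iff matrix_matrix_mult_def vector_matrix_mult_def mult.commute)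
  ultimately obtain K where K: "(\<chi> i. c i) ** K = mat 1"
    by (metis invertible_def)

  define Q where "Q x = (\<chi> j. - (transpose (Omega B x (d_t t j x)) *v
                       (\<Sum>i\<in>UNIV. (of_real (wt d i) * t x $ i) *s c i)))" for x
  have "\<T> x ** (\<chi> i. c i) = Q x" for x
  proof -
    have "(\<Sum>i\<in>UNIV. \<T> x $ j $ i *s c i) = Q x $ j" for j
    proof -
      have "(\<Sum>i\<in>UNIV. \<T> x $ j $ i *s c i) = phi B x (- Phi B x (d_t t j x) (euler_field T0 B x))"
        by (simp add: T phi_sum_scale c)
      also have "\<dots> = - (transpose (Omega B x (d_t t j x)) *v phi B x (euler_field T0 B x))"
        by (simp add: phi_uminus Phi_def surj_f_inv_f[OF phi_surj])
      also have "\<dots> = Q x $ j"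
        by (simp add: Q_def euler phi_sum_scale c)
      finally show ?thesis .
    qed
    then show ?thesis
      by (simp add: vec_eq_iff matrix_matrix_mult_def)
  qed
  then have "\<T> x = Q x ** K" for x
    by (metis K matrix_mul_assoc matrix_mul_rid)
  moreover have "is_poly (\<lambda>x. Q x $ i $ j)" for i j
    by (auto simp: Q_def matrix_vector_mult_def transpose_def Omega_def
        intro!: is_poly_sum is_poly_mult is_poly_uminus d_t_poly B_poly t_poly)
  ultimately have T_poly: "is_poly (\<lambda>x. \<T> x $ i $ j)" for i j
    by (auto simp: matrix_matrix_mult_def intro!: is_poly_sum is_poly_mult)

  have C_poly: "is_poly (\<lambda>x. \<C> x $ i $ j)" for i j
  proof -
    have "mono d"
      using assms(4) unfolding basic_invariants_def by blast
    then have "d i \<le> d last_ix"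
      unfolding last_ix_def by (intro monoD[of d]) auto
    then have "1 - wt d i + wt d j > 0"
      using basic_invariants_degree_pos[OF assms(4), of j]
        basic_invariants_degree_pos[OF assms(4), of last_ix]
      unfolding wt_def by (intro add_nonneg_pos) (auto simp: divide_simps)
    then have "\<C> x $ i $ j = - inverse (of_real (1 - wt d i + wt d j)) * \<T> x $ i $ j" for x
      using TC[of x i j] C_hom[of i j x]
      by (metis (no_types, lifting) less_irrefl minus_mult_minus mult.assoc left_inverse mult_1 of_real_eq_0_iff)
    then show ?thesis
      by (simp only:) (intro is_poly_mult is_poly_const T_poly)
  qed

  show ?thesis
  proof
    fix j
    have "1 + wt d j > 0"
      unfolding wt_def by (intro add_pos_nonneg) auto
    then have nz: "complex_of_real (1 + wt d j) \<noteq> 0"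
      by (metis less_irrefl of_real_eq_0_iff)
    let ?q = "\<lambda>x. inverse (of_real (1 + wt d j)) *
                    (\<Sum>i\<in>UNIV. (of_real (wt d i) * t x $ i) * \<C> x $ i $ j)"
    have "of_real (1 + wt d j) * g j x = (\<Sum>i\<in>UNIV. (of_real (wt d i) * t x $ i) * \<C> x $ i $ j)" for x
      using g_hom[of j x] unfolding euler lie_sum_scale by (simp add: C_g)
    then have "g j x = ?q x" for x
      using nz by (metis left_inverse mult.assoc mult_1)
    moreover have "is_poly ?q"
      by (intro is_poly_sum is_poly_mult is_poly_const t_poly C_poly)
    ultimately show "\<exists>p. is_poly p \<and> (\<forall>x. g j x = p (t x))"
      using is_poly_compose[OF _ s_poly, of ?q] st
      by (intro exI[of _ "\<lambda>y. ?q (s y)"]) auto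
  qed
qed

end
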